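(* Let $X$ be a real normed space and let $K\subset X$ be a convex body with central symmetrization $C=\frac12(K-K)$. Then for every $\mathbf{x}\in X$ with $\mathbf{x}\ne\mathbf{0}$, $$\left|\alpha(K,\mathbf{x})-\varphi_{\overline{C}}(\mathbf{x})\right|=\left|\alpha(K,\mathbf{x})-\frac{2\|\mathbf{x}\|}{\tau(K,\mathbf{x}/\|\mathbf{x}\|)}\right|\le\frac{2D(K)}{w(K)}-1.$$
   Context: $X$ is a real normed space, $X\neq\{0\}$; $X^*$ is its dual and $S^*$ the unit sphere of $X^*$. A convex body is a bounded, closed, convex set with nonempty interior. The central symmetrization of $K$ is $C=\{\frac12(\mathbf{x}-\mathbf{y}):\mathbf{x},\mathbf{y}\in K\}$ and $\overline{C}$ is its closure; $\varphi_{\overline{C}}(\mathbf{x})=\inf\{\lambda>0:\mathbf{x}\in\lambda\overline{C}\}$ is the classical Minkowski functional of $\overline{C}$. For $\mathbf{v}\neq\mathbf{0}$, $\tau(K,\mathbf{v})=\sup\{\lambda\ge0:\exists\,\mathbf{y},\mathbf{z}\in K\text{ with }\mathbf{z}=\mathbf{y}+\lambda\mathbf{v}\}$ is the "maximal chord" of $K$ in direction $\mathbf{v}$. The support function of $K$ is $h(K,\mathbf{v}^* )=\sup_{\mathbf{x}\in K}\langle \mathbf{v}^*,\mathbf{x}\rangle$; $w(K,\mathbf{v}^* )=h(K,\mathbf{v}^* )+h(K,-\mathbf{v}^* )$; $w(K)=\inf_{\mathbf{v}^*\in S^*}w(K,\mathbf{v}^* )$; and $D(K)=\sup_{\mathbf{x}\in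 K}\|\mathbf{x}\|$. For $\lambda\ge 0$ and $\mathbf{v}^*\in S^*$, with $r=-h(K,-\mathbf{v}^* )$ and $s=h(K,\mathbf{v}^* )$, set $$L^\lambda(K,\mathbf{v}^* )=\left\{\mathbf{x}\in X:\ \tfrac{\lambda+1}{2}r-\tfrac{\lambda-1}{2}s\le\langle\mathbf{v}^*,\mathbf{x}\rangle\le\tfrac{\lambda+1}{2}s-\tfrac{\lambda-1}{2}r\right\},\qquad K^\lambda=\bigcap_{\mathbf{v}^*\in S^*}L^\lambda(K,\mathbf{v}^* ).$$ The generalized Minkowski functional is $\alpha(K,\mathbf{x})=\inf\{\lambda\ge0:\mathbf{x}\in K^\lambda\}$, which is finite for every $\mathbf{x}\in X$. *)

theory Defs
  imports "HOL-Analysis.Analysis"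
begin

text \<open>The dual of a real normed space \<open>'a\<close> is the type \<open>'a \<Rightarrow>\<^sub>L real\<close> of bounded linear
  functionals with the operator norm, and its unit sphere is \<open>sphere 0 1\<close>. All suprema and infima
  are taken in \<open>real\<close>; for a convex body in a nontrivial space, and a nonzero direction \<open>v\<close> in
  \<open>max_chord\<close>, the sets involved are nonempty and bounded on the relevant side.\<close>

definition convex_body :: "'a::real_normed_vector set \<Rightarrow> bool" where
  "convex_body K \<longleftrightarrow> bounded K \<and> closed K \<and> convex K \<and> interior K \<noteq> {}"

definition central_symmetrization :: "'a::real_normed_vector set \<Rightarrow> 'a set" where
  "central_symmetrization K = {(1/2) *\<^sub>R (x - y) | x y. x \<in> K \<and> y \<in> K}"

definition minkowski_functional :: "'a::real_normed_vector set \<Rightarrow> 'a \<Rightarrow> real" where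
  "minkowski_functional A x = Inf {l. l > 0 \<and> x \<in> (\<lambda>y. l *\<^sub>R y) ` A}"

definition max_chord :: "'a::real_normed_vector set \<Rightarrow> 'a \<Rightarrow> real" where
  "max_chord K v = Sup {l. l \<ge> 0 \<and> (\<exists>y\<in>K. \<exists>z\<in>K. z = y + l *\<^sub>R v)}"

definition support_fun :: "'a::real_normed_vector set \<Rightarrow> ('a \<Rightarrow>\<^sub>L real) \<Rightarrow> real" where
  "support_fun K f = (SUP x\<in>K. blinfun_apply f x)"

definition dir_width :: "'a::real_normed_vector set \<Rightarrow> ('a \<Rightarrow>\<^sub>L real) \<Rightarrow> real" where
  "dir_width K f = support_fun K f + support_fun K (- f)"

definition min_width :: "'a::real_normed_vector set \<Rightarrow> real" where
  "min_width K = (INF f\<in>sphere 0 1. dir_width K f)"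

definition max_norm :: "'a::real_normed_vector set \<Rightarrow> real" where
  "max_norm K = (SUP x\<in>K. norm x)"

definition dilated_layer :: "real \<Rightarrow> 'a::real_normed_vector set \<Rightarrow> ('a \<Rightarrow>\<^sub>L real) \<Rightarrow> 'a set" where
  "dilated_layer l K f =
    (let r = - support_fun K (- f); s = support_fun K f in
      {x. (l + 1) / 2 * r - (l - 1) / 2 * s \<le> blinfun_apply f x \<and>
          blinfun_apply f x \<le> (l + 1) / 2 * s - (l - 1) / 2 * r})"

definition dilated_body :: "real \<Rightarrow> 'a::real_normed_vector set \<Rightarrow> 'a set" where
  "dilated_body l K = (\<Inter>f\<in>sphere 0 1. dilated_layer l K f)"

definition gen_minkowski_functional :: "'a::real_normed_vector set \<Rightarrow> 'a \<Rightarrow> real" where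
  "gen_minkowski_functional K x = Inf {l. l \<ge> 0 \<and> x \<in> dilated_body l K}"

end

theory Submission
  imports Defs
begin

text \<open>
  For a functional \<open>f\<close> of norm one write \<open>w\<^sub>f\<close> for the width of \<open>K\<close> along \<open>f\<close> and \<open>m\<^sub>f\<close> for the
  midpoint of the interval spanned by \<open>f\<close> on \<open>K\<close>. The layer of index \<open>l\<close> is
  \<open>{x. \<bar>f x - m\<^sub>f\<bar> \<le> l * w\<^sub>f / 2}\<close>, so the generalized functional \<open>\<alpha>\<close> at \<open>x\<close> is the supremum over \<open>f\<close>
  of the ratios \<open>\<bar>f x - m\<^sub>f\<bar> / (w\<^sub>f / 2)\<close>. The symmetrization \<open>C\<close> has half-width \<open>w\<^sub>f / 2\<close> and midpoint \<open>0\<close>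
  along \<open>f\<close>, so the classical functional \<open>\<phi>\<close> of its closure at \<open>x\<close> is the supremum of the ratios
  \<open>\<bar>f x\<bar> / (w\<^sub>f / 2)\<close>. Hence the two differ by at most the supremum of \<open>\<bar>m\<^sub>f\<bar> / (w\<^sub>f / 2)\<close>. Both
  ends of the interval spanned by \<open>f\<close> have modulus at most \<open>D\<close>, that is \<open>\<bar>m\<^sub>f\<bar> + w\<^sub>f / 2 \<le> D\<close>, and this
  turns the last ratio into at most \<open>2 * D / w\<^sub>f - 1 \<le> 2 * D / w - 1\<close>
  (\<open>asymmetry_bound\<close>, \<open>gen_minkowski_functional_close\<close>).

  The inequality \<open>\<phi> \<le> \<alpha> + (2 * D / w - 1)\<close> needs the description of \<open>\<phi>\<close> by functionals: a point
  outside \<open>C\<close> must be separated from \<open>C\<close> by some \<open>f\<close>. This is a separation theorem in an arbitrary normed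
  space (\<open>convex_support_functional\<close>), obtained from the Hahn-Banach theorem. The latter is proved
  without extending functionals from subspaces: a minimal sublinear functional below a given one
  exists by Zorn's lemma and is automatically linear.

  The maximal chord enters because \<open>l *\<^sub>R v\<close> is a difference of two points of \<open>K\<close> exactly when
  \<open>(l / 2) *\<^sub>R v\<close> lies in \<open>C\<close>; thus half the maximal chord is the supremum of the factors
  \<open>t\<close> with \<open>t *\<^sub>R v\<close> in \<open>C\<close>, the reciprocal of \<open>\<phi>\<close> at \<open>v\<close>. Passing from \<open>C\<close>
  to its closure does not change this, since every proper contraction of the closure is contained in \<open>C\<close> (\<open>convex_scaled_closure_subset\<close>).
\<close>

section \<open>The Hahn-Banach theorem for sublinear functionals\<close>

text \<open>For positive factors the inequality is equivalent to homogeneity (apply it to \<open>c\<close> and to \<open>1 / c\<close>),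
  and it is the easier half to check for functionals defined as infima.\<close>

definition sublinear :: "('a::real_vector \<Rightarrow> real) \<Rightarrow> bool" where
  "sublinear p \<longleftrightarrow> (\<forall>x y. p (x + y) \<le> p x + p y) \<and> (\<forall>c>0. \<forall>x. p (c *\<^sub>R x) \<le> c * p x)"

lemma sublinear_add: "sublinear p \<Longrightarrow> p (x + y) \<le> p x + p y"
  and sublinear_scale_le: "sublinear p \<Longrightarrow> c > 0 \<Longrightarrow> p (c *\<^sub>R x) \<le> c * p x"
  by (auto simp: sublinear_def)

lemma sublinear_zero:
  assumes "sublinear p" shows "p 0 = 0"
proof -
  have "p 0 \<le> p 0 + p 0" "p 0 \<le> (1/2) * p 0"
    using sublinear_add[OF assms, of 0 0] sublinear_scale_le[OF assms, of "1/2" 0] by auto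
  then show ?thesis by linarith
qed

lemma sublinear_scale:
  assumes "sublinear p" "c > 0" shows "p (c *\<^sub>R x) = c * p x"
proof (rule antisym)
  have "p ((1/c) *\<^sub>R (c *\<^sub>R x)) \<le> (1/c) * p (c *\<^sub>R x)"
    using assms by (intro sublinear_scale_le) auto
  then show "c * p x \<le> p (c *\<^sub>R x)" using assms by (simp add: field_simps)
qed (use assms sublinear_scale_le in blast)

lemma sublinear_scale_nonneg:
  assumes "sublinear p" "c \<ge> 0" shows "p (c *\<^sub>R x) = c * p x"
  using sublinear_scale[OF assms(1)] sublinear_zero[OF assms(1)] assms(2)
  by (cases "c = 0") auto

lemma sublinear_minus:
  assumes "sublinear p" shows "- p (- x) \<le> p x"
  using sublinear_add[OF assms, of x "- x"] sublinear_zero[OF assms] by simp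

lemma sublinear_odd_imp_linear:
  assumes p: "sublinear p" and odd: "\<And>x. p (- x) = - p x"
  shows "linear p"
proof (rule linearI)
  fix x y :: 'a and c :: real
  have "- p (x + y) = p (- x + - y)" using odd[of "x + y"] by simp
  also have "\<dots> \<le> - p x - p y" using sublinear_add[OF p, of "- x" "- y"] odd by simp
  finally show "p (x + y) = p x + p y" using sublinear_add[OF p, of x y] by linarith
  show "p (c *\<^sub>R x) = c *\<^sub>R p x"
  proof (cases "c \<ge> 0")
    case False
    then have "p (- ((- c) *\<^sub>R x)) = - ((- c) * p x)"
      using sublinear_scale_nonneg[OF p, of "- c" x] odd by simp
    then show ?thesis by simp
  qed (simp add: sublinear_scale_nonneg[OF p])
qed

text \<open>Among the sublinear functionals below \<open>p\<close>, this is the largest one whose value at \<open>- z\<close> is at most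
  \<open>- p z\<close>. It forces oddness in the direction \<open>z\<close>, which is used twice: to pin the value of a
  functional at a prescribed point, and to show that minimal functionals are odd everywhere.\<close>

definition tilt :: "('a::real_vector \<Rightarrow> real) \<Rightarrow> 'a \<Rightarrow> 'a \<Rightarrow> real" where
  "tilt p z x = (INF t\<in>{0..}. p (x + t *\<^sub>R z) - t * p z)"

lemma tilt_lower:
  assumes p: "sublinear p" and "t \<ge> 0"
  shows "tilt p z x \<le> p (x + t *\<^sub>R z) - t * p z"
  unfolding tilt_def
proof (rule cINF_lower)
  show "bdd_below ((\<lambda>t. p (x + t *\<^sub>R z) - t * p z) ` {0..})"
  proof (rule bdd_belowI2)
    fix t :: real assume "t \<in> {0..}"
    then show "- p (- x) \<le> p (x + t *\<^sub>R z) - t * p z"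
      using sublinear_add[OF p, of "x + t *\<^sub>R z" "- x"] sublinear_scale_nonneg[OF p, of t z]
      by (simp add: algebra_simps)
  qed
qed (use assms in auto)

lemma tilt_greatest:
  assumes "\<And>t. t \<ge> 0 \<Longrightarrow> m \<le> p (x + t *\<^sub>R z) - t * p z"
  shows "m \<le> tilt p z x"
  unfolding tilt_def by (rule cINF_greatest) (use assms in auto)

lemma tilt_le: "sublinear p \<Longrightarrow> tilt p z x \<le> p x"
  using tilt_lower[of p 0 z x] by simp

lemma tilt_minus: "sublinear p \<Longrightarrow> tilt p z (- z) \<le> - p z"
  using tilt_lower[of p 1 z "- z"] by (simp add: sublinear_zero)

text \<open>If \<open>t\<close> is almost optimal for \<open>x\<close> and \<open>s\<close> for \<open>y\<close>, then \<open>t + s\<close> is a competitor for \<open>x + y\<close> and \<open>c * t\<close>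
  one for \<open>c *\<^sub>R x\<close>. Nesting two applications of \<open>tilt_greatest\<close> expresses this without epsilons.\<close>

lemma sublinear_tilt:
  assumes p: "sublinear p" shows "sublinear (tilt p z)"
  unfolding sublinear_def
proof (intro conjI allI impI)
  fix x y
  have "tilt p z (x + y) - tilt p z y \<le> tilt p z x"
  proof (rule tilt_greatest)
    fix t :: real assume t: "t \<ge> 0"
    have "tilt p z (x + y) - (p (x + t *\<^sub>R z) - t * p z) \<le> tilt p z y"
    proof (rule tilt_greatest)
      fix s :: real assume s: "s \<ge> 0"
      have "tilt p z (x + y) \<le> p (x + y + (t + s) *\<^sub>R z) - (t + s) * p z"
        using p s t by (intro tilt_lower) auto
      moreover have "x + y + (t + s) *\<^sub>R z = (x + t *\<^sub>R z) + (y + s *\<^sub>R z)"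
        by (simp add: algebra_simps)
      ultimately show "tilt p z (x + y) - (p (x + t *\<^sub>R z) - t * p z)
          \<le> p (y + s *\<^sub>R z) - s * p z"
        using sublinear_add[OF p, of "x + t *\<^sub>R z" "y + s *\<^sub>R z"] by (simp add: algebra_simps)
    qed
    then show "tilt p z (x + y) - tilt p z y \<le> p (x + t *\<^sub>R z) - t * p z" by linarith
  qed
  then show "tilt p z (x + y) \<le> tilt p z x + tilt p z y" by linarith
next
  fix c :: real and x assume c: "c > 0"
  have "tilt p z (c *\<^sub>R x) / c \<le> tilt p z x"
  proof (rule tilt_greatest)
    fix t :: real assume t: "t \<ge> 0"
    have "tilt p z (c *\<^sub>R x) \<le> p (c *\<^sub>R x + (c * t) *\<^sub>R z) - (c * t) * p z"
      using p c t by (intro tilt_lower) auto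
    also have "c *\<^sub>R x + (c * t) *\<^sub>R z = c *\<^sub>R (x + t *\<^sub>R z)" by (simp add: algebra_simps)
    also have "p \<dots> = c * p (x + t *\<^sub>R z)" using sublinear_scale[OF p c] .
    finally show "tilt p z (c *\<^sub>R x) / c \<le> p (x + t *\<^sub>R z) - t * p z"
      using c by (simp add: field_simps)
  qed
  then show "tilt p z (c *\<^sub>R x) \<le> c * tilt p z x" using c by (simp add: field_simps)
qed

text \<open>An infimum of sublinear functionals need not be subadditive. Along a chain it is, because two
  members \<open>q\<close> and \<open>r\<close> that almost attain the infimum at \<open>x\<close> and at \<open>y\<close> can be replaced by the smaller one.\<close>

lemma sublinear_INF_chain:
  assumes ne: "C \<noteq> {}"
    and sub: "\<And>q. q \<in> C \<Longrightarrow> sublinear q"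
    and chain: "\<And>q r. q \<in> C \<Longrightarrow> r \<in> C \<Longrightarrow> q \<le> r \<or> r \<le> q"
    and bdd: "\<And>x. bdd_below ((\<lambda>q. q x) ` C)"
  shows "sublinear (\<lambda>x. INF q\<in>C. q x)"
  unfolding sublinear_def
proof (intro conjI allI impI)
  fix x y :: 'a
  have lower: "(INF q\<in>C. q u) \<le> q u" if "q \<in> C" for q u
    using bdd that by (rule cINF_lower)
  have "(INF q\<in>C. q (x + y)) - (INF q\<in>C. q y) \<le> (INF q\<in>C. q x)"
  proof (rule cINF_greatest[OF ne])
    fix q assume q: "q \<in> C"
    have "(INF q\<in>C. q (x + y)) - q x \<le> (INF q\<in>C. q y)"
    proof (rule cINF_greatest[OF ne])
      fix r assume r: "r \<in> C"
      from chain[OF q r] obtain m where m: "m \<in> C" "m \<le> q" "m \<le> r"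
        using q r by blast
      show "(INF q\<in>C. q (x + y)) - q x \<le> r y"
        using lower[OF m(1), of "x + y"] sublinear_add[OF sub[OF m(1)], of x y]
          le_funD[OF m(2), of x] le_funD[OF m(3), of y] by linarith
    qed
    then show "(INF q\<in>C. q (x + y)) - (INF q\<in>C. q y) \<le> q x" by linarith
  qed
  then show "(INF q\<in>C. q (x + y)) \<le> (INF q\<in>C. q x) + (INF q\<in>C. q y)" by linarith
next
  fix c :: real and x :: 'a assume c: "c > 0"
  have "(INF q\<in>C. q (c *\<^sub>R x)) / c \<le> (INF q\<in>C. q x)"
  proof (rule cINF_greatest[OF ne])
    fix q assume q: "q \<in> C"
    have "(INF q\<in>C. q (c *\<^sub>R x)) \<le> q (c *\<^sub>R x)"
      using bdd q by (rule cINF_lower)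
    then show "(INF q\<in>C. q (c *\<^sub>R x)) / c \<le> q x"
      using sublinear_scale[OF sub[OF q] c] c by (simp add: field_simps)
  qed
  then show "(INF q\<in>C. q (c *\<^sub>R x)) \<le> c * (INF q\<in>C. q x)" using c by (simp add: field_simps)
qed

text \<open>Zorn's lemma for the reversed pointwise order. A chain of functionals below \<open>p\<close> cannot escape to
  minus infinity, as \<open>q x \<ge> - q (- x) \<ge> - p (- x)\<close>.\<close>

lemma minimal_sublinear_exists:
  assumes p: "sublinear (p :: 'a::real_vector \<Rightarrow> real)"
  obtains f where "sublinear f" "f \<le> p" "\<And>q. sublinear q \<Longrightarrow> q \<le> f \<Longrightarrow> q = f"
proof -
  define A where "A = {q. sublinear q \<and> q \<le> p}"
  have "\<exists>m\<in>A. \<forall>a\<in>A. a \<le> m \<longrightarrow> a = m"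
  proof (rule predicate_Zorn)
    show "partial_order_on A (relation_of (\<lambda>a b. b \<le> a) A)"
      by (rule partial_order_on_relation_ofI) auto
  next
    fix C assume C: "C \<in> Chains (relation_of (\<lambda>a b. b \<le> a) A)"
    then have CA: "C \<subseteq> A"
      and chain: "\<And>q r. q \<in> C \<Longrightarrow> r \<in> C \<Longrightarrow> q \<le> r \<or> r \<le> q"
      unfolding Chains_def relation_of_def by auto
    show "\<exists>u\<in>A. \<forall>a\<in>C. u \<le> a"
    proof (cases "C = {}")
      case True
      then show ?thesis using p by (auto simp: A_def)
    next
      case False
      define u where "u = (\<lambda>x. INF q\<in>C. q x)"
      have bdd: "bdd_below ((\<lambda>q. q x) ` C)" for x
      proof (rule bdd_belowI2)
        fix q assume "q \<in> C"
        then have q: "sublinear q" "q \<le> p" using CA by (auto simp: A_def)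
        show "- p (- x) \<le> q x"
          using sublinear_minus[OF q(1), of x] le_funD[OF q(2), of "- x"] by linarith
      qed
      have low: "u \<le> q" if "q \<in> C" for q
        unfolding u_def by (rule le_funI, rule cINF_lower) (use bdd that in auto)
      have "sublinear u"
        unfolding u_def using False CA chain bdd
        by (intro sublinear_INF_chain) (auto simp: A_def)
      moreover have "u \<le> p"
        using low False CA by (force simp: A_def intro: order_trans)
      ultimately show ?thesis using low by (auto simp: A_def)
    qed
  qed
  then show thesis using that unfolding A_def
    by (metis (mono_tags, lifting) mem_Collect_eq order_trans)
qed

text \<open>A minimal sublinear \<open>f\<close> coincides with each of its tilts, hence is odd, hence linear. Starting the
  minimization from \<open>tilt p y\<close> rather than from \<open>p\<close> gives \<open>f (- y) \<le> - p y\<close>, which for linear \<open>f\<close> is the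
  missing inequality \<open>p y \<le> f y\<close>.\<close>

theorem hahn_banach_sublinear:
  assumes p: "sublinear (p :: 'a::real_vector \<Rightarrow> real)"
  obtains f where "linear f" "\<And>x. f x \<le> p x" "f y = p y"
proof -
  obtain f where f: "sublinear f" "f \<le> tilt p y"
    and fmin: "\<And>q. sublinear q \<Longrightarrow> q \<le> f \<Longrightarrow> q = f"
    using minimal_sublinear_exists[OF sublinear_tilt[OF p]] by metis
  \<comment> \<open>Minimality is used against \<open>tilt f z\<close>, for each direction \<open>z\<close> separately.\<close>
  have odd: "f (- z) = - f z" for z
  proof (rule antisym)
    have "tilt f z = f"
      using sublinear_tilt[OF f(1)] tilt_le[OF f(1)] by (intro fmin le_funI)
    then show "f (- z) \<le> - f z" using tilt_minus[OF f(1), of z] by simp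
    show "- f z \<le> f (- z)" using sublinear_minus[OF f(1), of "- z"] by simp
  qed
  have le: "f x \<le> p x" for x
    using le_funD[OF f(2), of x] tilt_le[OF p, of y x] by linarith
  moreover have "p y \<le> f y"
    using le_funD[OF f(2), of "- y"] tilt_minus[OF p, of y] odd[of y] by linarith
  ultimately show thesis
    using that sublinear_odd_imp_linear[OF f(1) odd] by (simp add: antisym)
qed

section \<open>Minkowski functionals and separation\<close>

lemma mem_scaled_iff:
  fixes x :: "'a::real_normed_vector"
  assumes "l > 0"
  shows "x \<in> (\<lambda>y. l *\<^sub>R y) ` A \<longleftrightarrow> (1/l) *\<^sub>R x \<in> A"
proof
  show "(1/l) *\<^sub>R x \<in> A" if "x \<in> (\<lambda>y. l *\<^sub>R y) ` A" using that assms by auto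
  show "x \<in> (\<lambda>y. l *\<^sub>R y) ` A" if "(1/l) *\<^sub>R x \<in> A"
    using that assms by (intro image_eqI[where x = "(1/l) *\<^sub>R x"]) auto
qed

lemma minkowski_functional_alt:
  "minkowski_functional A x = Inf {l. l > 0 \<and> (1/l) *\<^sub>R x \<in> A}"
  unfolding minkowski_functional_def using mem_scaled_iff by (metis (mono_tags, lifting))

lemma minkowski_functional_le:
  "l > 0 \<Longrightarrow> (1/l) *\<^sub>R x \<in> A \<Longrightarrow> minkowski_functional A x \<le> l"
  unfolding minkowski_functional_alt
  by (rule cInf_lower) (auto intro!: bdd_belowI[where m = 0])

lemma absorbing:
  assumes "ball 0 \<rho> \<subseteq> A" "norm x < l * \<rho>" "l > 0"
  shows "(1/l) *\<^sub>R (x :: 'a::real_normed_vector) \<in> A"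
proof -
  have "(1/l) *\<^sub>R x \<in> ball 0 \<rho>" using assms by (simp add: field_simps)
  then show ?thesis using assms by blast
qed

lemma absorbing_ex:
  fixes x :: "'a::real_normed_vector"
  assumes "ball 0 \<rho> \<subseteq> A" "\<rho> > 0"
  obtains l where "l > 0" "(1/l) *\<^sub>R x \<in> A"
proof -
  let ?l = "(norm x + 1) / \<rho>"
  have l: "?l > 0" using assms(2) by (intro divide_pos_pos add_nonneg_pos) auto
  moreover have "(1 / ?l) *\<^sub>R x \<in> A"
    by (rule absorbing[OF assms(1) _ l]) (use assms(2) in simp)
  ultimately show thesis by (rule that)
qed

lemma minkowski_functional_greatest:
  assumes "ball 0 \<rho> \<subseteq> A" "\<rho> > 0"
    and "\<And>l. l > 0 \<Longrightarrow> (1/l) *\<^sub>R x \<in> A \<Longrightarrow> m \<le> l"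
  shows "m \<le> minkowski_functional A (x :: 'a::real_normed_vector)"
  unfolding minkowski_functional_alt
proof (rule cInf_greatest)
  show "{l. l > 0 \<and> (1/l) *\<^sub>R x \<in> A} \<noteq> {}"
    using absorbing_ex[OF assms(1,2), of x] by blast
qed (use assms in auto)

lemma sublinear_minkowski_functional:
  fixes A :: "'a::real_normed_vector set"
  assumes A: "convex A" and ball: "ball 0 \<rho> \<subseteq> A" "\<rho> > 0"
  shows "sublinear (minkowski_functional A)"
  unfolding sublinear_def
proof (intro conjI allI impI)
  fix x y :: 'a
  have "minkowski_functional A (x + y) - minkowski_functional A y \<le> minkowski_functional A x"
  proof (rule minkowski_functional_greatest[OF ball])
    fix l :: real assume l: "l > 0" "(1/l) *\<^sub>R x \<in> A"
    have "minkowski_functional A (x + y) - l \<le> minkowski_functional A y"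
    proof (rule minkowski_functional_greatest[OF ball])
      fix m :: real assume m: "m > 0" "(1/m) *\<^sub>R y \<in> A"
      have "(l/(l+m)) *\<^sub>R ((1/l) *\<^sub>R x) + (m/(l+m)) *\<^sub>R ((1/m) *\<^sub>R y) \<in> A"
        using l m by (intro convexD[OF A]) (auto simp flip: add_divide_distrib)
      then have "(1/(l+m)) *\<^sub>R (x + y) \<in> A"
        using l m by (simp add: scaleR_add_right)
      then have "minkowski_functional A (x + y) \<le> l + m"
        using l m by (intro minkowski_functional_le) auto
      then show "minkowski_functional A (x + y) - l \<le> m" by linarith
    qed
    then show "minkowski_functional A (x + y) - minkowski_functional A y \<le> l" by linarith
  qed
  then show "minkowski_functional A (x + y) \<le> minkowski_functional A x + minkowski_functional A y"
    by linarith
next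
  fix c :: real and x :: 'a assume c: "c > 0"
  have "minkowski_functional A (c *\<^sub>R x) / c \<le> minkowski_functional A x"
  proof (rule minkowski_functional_greatest[OF ball])
    fix l :: real assume l: "l > 0" "(1/l) *\<^sub>R x \<in> A"
    then have "minkowski_functional A (c *\<^sub>R x) \<le> c * l"
      using c by (intro minkowski_functional_le) auto
    then show "minkowski_functional A (c *\<^sub>R x) / c \<le> l" using c by (simp add: field_simps)
  qed
  then show "minkowski_functional A (c *\<^sub>R x) \<le> c * minkowski_functional A x"
    using c by (simp add: field_simps)
qed

text \<open>The Hahn-Banach functional below the Minkowski functional of \<open>A\<close> that touches it at \<open>y\<close> is at most \<open>1\<close>
  on \<open>A\<close> and at least \<open>1\<close> at \<open>y\<close>. It is continuous because \<open>A\<close> contains a ball, so that it can be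
  normalized.\<close>

theorem convex_support_functional:
  fixes A :: "'a::real_normed_vector set"
  assumes A: "convex A" and ball: "ball 0 \<rho> \<subseteq> A" "\<rho> > 0" and y: "y \<notin> A"
  obtains f :: "'a \<Rightarrow>\<^sub>L real" where "norm f = 1" "\<And>a. a \<in> A \<Longrightarrow> blinfun_apply f a \<le> blinfun_apply f y"
proof -
  let ?p = "minkowski_functional A"
  obtain g where g: "linear g" "\<And>x. g x \<le> ?p x" "g y = ?p y"
    using hahn_banach_sublinear[OF sublinear_minkowski_functional[OF A ball]] by metis
  have g_le: "g x \<le> norm x * (2/\<rho>)" for x
  proof (cases "x = 0")
    case False
    have "?p x \<le> norm x * (2/\<rho>)"
      using False ball by (intro minkowski_functional_le absorbing[OF ball(1)]) auto
    then show ?thesis using g(2)[of x] by linarith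
  qed (simp add: linear_0[OF g(1)])
  have "bounded_linear g"
  proof (rule bounded_linear_intro)
    show "g (x + z) = g x + g z" for x z by (rule linear_add[OF g(1)])
    show "g (c *\<^sub>R x) = c *\<^sub>R g x" for c x by (rule linear_cmul[OF g(1)])
    show "norm (g x) \<le> norm x * (2/\<rho>)" for x
      using g_le[of x] g_le[of "- x"] linear_neg[OF g(1), of x] by auto
  qed
  then have G: "blinfun_apply (Blinfun g) = g" by (rule bounded_linear_Blinfun_apply)
  have "1 \<le> g y"
    unfolding g(3)
  proof (rule minkowski_functional_greatest[OF ball])
    fix l :: real assume l: "l > 0" "(1/l) *\<^sub>R y \<in> A"
    show "1 \<le> l"
    proof (rule ccontr)
      assume "\<not> 1 \<le> l"
      moreover have "0 \<in> A" using ball by auto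
      ultimately have "l *\<^sub>R ((1/l) *\<^sub>R y) + (1 - l) *\<^sub>R 0 \<in> A"
        using l by (intro convexD[OF A]) auto
      then show False using l y by simp
    qed
  qed
  moreover have "g a \<le> 1" if "a \<in> A" for a
    using g(2)[of a] minkowski_functional_le[of 1 a A] that by simp
  ultimately have le: "g a \<le> g y" if "a \<in> A" for a using that by force
  have "Blinfun g \<noteq> 0"
    using \<open>1 \<le> g y\<close> G by (metis blinfun.zero_left not_one_le_zero)
  then have "norm (Blinfun g /\<^sub>R norm (Blinfun g)) = 1" by simp
  moreover have "blinfun_apply (Blinfun g /\<^sub>R norm (Blinfun g)) a
      \<le> blinfun_apply (Blinfun g /\<^sub>R norm (Blinfun g)) y" if "a \<in> A" for a
    using le[OF that] by (simp add: blinfun.scaleR_left G mult_left_mono)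
  ultimately show thesis using that by blast
qed

text \<open>Approximate \<open>y\<close> by \<open>a\<close> in \<open>A\<close> and write \<open>t *\<^sub>R y\<close> as the convex combination
  \<open>t *\<^sub>R a + (1 - t) *\<^sub>R b\<close>. The error \<open>y - a\<close> is absorbed into \<open>b\<close>, which lies in the given ball once \<open>a\<close>
  is close enough to \<open>y\<close>.\<close>

lemma convex_scaled_closure_subset:
  fixes A :: "'a::real_normed_vector set"
  assumes A: "convex A" and ball: "ball 0 \<rho> \<subseteq> A" "\<rho> > 0"
    and y: "y \<in> closure A" and t: "0 < t" "t < 1"
  shows "t *\<^sub>R y \<in> A"
proof -
  have "(1 - t) * \<rho> / t > 0" using t ball by simp
  then obtain a where a: "a \<in> A" "dist a y < (1 - t) * \<rho> / t"
    using y unfolding closure_approachable by blast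
  let ?b = "(t / (1 - t)) *\<^sub>R (y - a)"
  have "norm ?b = t / (1 - t) * dist a y"
    using t by (simp add: dist_norm norm_minus_commute)
  also have "\<dots> < t / (1 - t) * ((1 - t) * \<rho> / t)"
    using a(2) t by (intro mult_strict_left_mono) auto
  also have "\<dots> = \<rho>" using t by simp
  finally have "norm ?b < \<rho>" .
  then have "?b \<in> A" using ball by auto
  then have "t *\<^sub>R a + (1 - t) *\<^sub>R ?b \<in> A"
    using a t by (intro convexD[OF A]) auto
  then show ?thesis using t by (simp add: scaleR_diff_right)
qed

section \<open>Support functions and widths\<close>

lemma support_fun_upper:
  assumes "bounded K" "x \<in> K" shows "blinfun_apply f x \<le> support_fun K f"
  unfolding support_fun_def
proof (rule cSUP_upper[OF assms(2)])
  have "bounded (blinfun_apply f ` K)"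
    using bounded_linear_image[OF assms(1) blinfun.bounded_linear_right] .
  then show "bdd_above (blinfun_apply f ` K)" by (rule bounded_imp_bdd_above)
qed

lemma support_fun_le:
  assumes "K \<noteq> {}" "\<And>x. x \<in> K \<Longrightarrow> blinfun_apply f x \<le> m" shows "support_fun K f \<le> m"
  unfolding support_fun_def by (rule cSUP_least) (use assms in auto)

text \<open>Centred form of the layer: its midpoint along \<open>f\<close> is that of \<open>K\<close>, and its half-width is \<open>l\<close> times
  that of \<open>K\<close>.\<close>

lemma mem_dilated_layer_iff:
  "x \<in> dilated_layer l K f \<longleftrightarrow>
    \<bar>blinfun_apply f x - (support_fun K f - support_fun K (- f)) / 2\<bar> \<le> l * (dir_width K f / 2)"
  unfolding dilated_layer_def dir_width_def Let_def abs_le_iff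
  by (auto simp: field_simps)

lemma dir_width_le:
  assumes "K \<noteq> {}" "\<And>y z. y \<in> K \<Longrightarrow> z \<in> K \<Longrightarrow> blinfun_apply f y - blinfun_apply f z \<le> m"
  shows "dir_width K f \<le> m"
proof -
  have "support_fun K (- f) \<le> m - support_fun K f"
  proof (rule support_fun_le[OF assms(1)])
    fix z assume "z \<in> K"
    then have "support_fun K f \<le> m + blinfun_apply f z"
      using assms(2) by (intro support_fun_le[OF assms(1)]) (auto simp: algebra_simps)
    then show "blinfun_apply (- f) z \<le> m - support_fun K f"
      by (simp add: blinfun.minus_left)
  qed
  then show ?thesis by (simp add: dir_width_def)
qed

lemma support_fun_le_max_norm:
  assumes "bounded K" "K \<noteq> {}" "norm f = 1" shows "support_fun K f \<le> max_norm K"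
proof (rule support_fun_le[OF assms(2)])
  fix x assume x: "x \<in> K"
  have "blinfun_apply f x \<le> norm x" using norm_blinfun[of f x] assms(3) by simp
  also have "norm x \<le> max_norm K"
    unfolding max_norm_def
    by (rule cSUP_upper[OF x]) (use assms(1) in \<open>simp add: bounded_imp_bdd_above bounded_norm_comp\<close>)
  finally show "blinfun_apply f x \<le> max_norm K" .
qed

section \<open>The central symmetrization\<close>

lemma convex_central_symmetrization:
  assumes "convex K" shows "convex (central_symmetrization K)"
proof -
  have "central_symmetrization K = (\<lambda>z. (1/2) *\<^sub>R z) ` (\<Union>x\<in>K. \<Union>y\<in>K. {x - y})"
    unfolding central_symmetrization_def by auto
  then show ?thesis using convex_scaling[OF convex_differences[OF assms assms]] by simp
qed

lemma central_symmetrization_ball: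
  assumes "interior K \<noteq> {}"
  obtains \<rho> where "\<rho> > 0" "ball 0 \<rho> \<subseteq> central_symmetrization K"
proof -
  obtain c \<epsilon> where c: "\<epsilon> > 0" "ball c \<epsilon> \<subseteq> K" using assms mem_interior by blast
  have "y \<in> central_symmetrization K" if "y \<in> ball 0 (\<epsilon> / 2)" for y
  proof -
    have "c + 2 *\<^sub>R y \<in> ball c \<epsilon>" "c \<in> ball c \<epsilon>" using that c(1) by (auto simp: dist_norm)
    then have "c + 2 *\<^sub>R y \<in> K" "c \<in> K" using c(2) by auto
    moreover have "y = (1/2) *\<^sub>R (c + 2 *\<^sub>R y - c)" by simp
    ultimately show ?thesis unfolding central_symmetrization_def by blast
  qed
  then have "ball 0 (\<epsilon> / 2) \<subseteq> central_symmetrization K" by blast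
  then show thesis using that[of "\<epsilon> / 2"] c(1) by simp
qed

lemma closure_central_symmetrization_dir_width:
  assumes K: "bounded K" and c: "c \<in> closure (central_symmetrization K)"
  shows "\<bar>blinfun_apply f c\<bar> \<le> dir_width K f / 2"
proof -
  have "closure (central_symmetrization K) \<subseteq> {c. \<bar>blinfun_apply f c\<bar> \<le> dir_width K f / 2}"
  proof (rule closure_minimal)
    show "closed {c. \<bar>blinfun_apply f c\<bar> \<le> dir_width K f / 2}"
      by (intro closed_Collect_le continuous_intros)
    show "central_symmetrization K \<subseteq> {c. \<bar>blinfun_apply f c\<bar> \<le> dir_width K f / 2}"
    proof
      fix c assume "c \<in> central_symmetrization K"
      then obtain y z where yz: "y \<in> K" "z \<in> K" "c = (1/2) *\<^sub>R (y - z)"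
        unfolding central_symmetrization_def by blast
      have "blinfun_apply f c = (blinfun_apply f y - blinfun_apply f z) / 2"
        by (simp add: yz(3) blinfun.scaleR_right blinfun.diff_right)
      then show "c \<in> {c. \<bar>blinfun_apply f c\<bar> \<le> dir_width K f / 2}"
        using support_fun_upper[OF K yz(1), of f] support_fun_upper[OF K yz(2), of f]
          support_fun_upper[OF K yz(1), of "- f"] support_fun_upper[OF K yz(2), of "- f"]
        by (simp add: dir_width_def blinfun.minus_left abs_le_iff)
    qed
  qed
  then show ?thesis using c by blast
qed

text \<open>This makes the minimal width positive: on the ball, \<open>f\<close> comes close to \<open>\<rho>\<close>, whereas on the
  symmetrization it is at most half the width. Evaluating on the sphere of radius \<open>\<rho> / 2\<close> bounds the
  operator norm of \<open>f\<close> accordingly.\<close>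

lemma central_symmetrization_ball_le_dir_width:
  assumes K: "bounded K" and ball: "\<rho> > 0" "ball 0 \<rho> \<subseteq> central_symmetrization K"
    and f: "norm f = 1"
  shows "\<rho> \<le> dir_width K f"
proof -
  have bound: "\<bar>blinfun_apply f c\<bar> \<le> dir_width K f / 2" if "c \<in> ball 0 \<rho>" for c
    using closure_central_symmetrization_dir_width[OF K] closure_subset ball(2) that by blast
  have "norm f \<le> dir_width K f / \<rho>"
  proof (rule norm_blinfun_bound)
    show "0 \<le> dir_width K f / \<rho>" using bound[of 0] ball(1) by simp
    fix x
    show "norm (blinfun_apply f x) \<le> dir_width K f / \<rho> * norm x"
    proof (cases "x = 0")
      case False
      then have "(\<rho> / 2 / norm x) *\<^sub>R x \<in> ball 0 \<rho>" using ball(1) by simp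
      then have "\<bar>(\<rho> / 2 / norm x) * blinfun_apply f x\<bar> \<le> dir_width K f / 2"
        using bound by (metis blinfun.scaleR_right real_scaleR_def)
      then show ?thesis using False ball(1) by (simp add: abs_mult field_simps)
    qed simp
  qed
  then show ?thesis using f ball(1) by (simp add: field_simps)
qed

lemma central_symmetrization_separation:
  fixes K :: "'a::real_normed_vector set"
  assumes K: "convex K" "K \<noteq> {}" and ball: "\<rho> > 0" "ball 0 \<rho> \<subseteq> central_symmetrization K"
    and y: "y \<notin> central_symmetrization K"
  obtains f where "norm f = 1" "dir_width K f / 2 \<le> blinfun_apply f y"
proof -
  obtain f :: "'a \<Rightarrow>\<^sub>L real" where f: "norm f = 1"
      "\<And>c. c \<in> central_symmetrization K \<Longrightarrow> blinfun_apply f c \<le> blinfun_apply f y"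
    by (rule convex_support_functional[OF convex_central_symmetrization[OF K(1)] ball(2,1) y]) blast
  have "dir_width K f \<le> 2 * blinfun_apply f y"
  proof (rule dir_width_le[OF K(2)])
    fix u v assume "u \<in> K" "v \<in> K"
    then have "(1/2) *\<^sub>R (u - v) \<in> central_symmetrization K"
      unfolding central_symmetrization_def by blast
    then show "blinfun_apply f u - blinfun_apply f v \<le> 2 * blinfun_apply f y"
      using f(2) by (force simp: blinfun.scaleR_right blinfun.diff_right)
  qed
  then show thesis using that f(1) by simp
qed

lemma chord_iff_central_symmetrization:
  "(\<exists>y\<in>K. \<exists>z\<in>K. z = y + l *\<^sub>R v) \<longleftrightarrow> (l / 2) *\<^sub>R v \<in> central_symmetrization K"
proof
  assume "\<exists>y\<in>K. \<exists>z\<in>K. z = y + l *\<^sub>R v"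
  then obtain y z where "y \<in> K" "z \<in> K" "z = y + l *\<^sub>R v" by blast
  moreover from this have "(l / 2) *\<^sub>R v = (1/2) *\<^sub>R (z - y)" by simp
  ultimately show "(l / 2) *\<^sub>R v \<in> central_symmetrization K"
    unfolding central_symmetrization_def by blast
next
  assume "(l / 2) *\<^sub>R v \<in> central_symmetrization K"
  then obtain y z where yz: "y \<in> K" "z \<in> K" "(l / 2) *\<^sub>R v = (1/2) *\<^sub>R (z - y)"
    unfolding central_symmetrization_def by blast
  have "2 *\<^sub>R ((l / 2) *\<^sub>R v) = 2 *\<^sub>R ((1/2) *\<^sub>R (z - y))" by (simp only: yz(3))
  then have "z = y + l *\<^sub>R v" by simp
  then show "\<exists>y\<in>K. \<exists>z\<in>K. z = y + l *\<^sub>R v" using yz by blast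
qed

text \<open>The map \<open>l \<mapsto> 2 / l\<close> exchanges the positive chord lengths in direction \<open>v\<close> with the factors \<open>l\<close> for which
  \<open>v\<close> lies in the \<open>l\<close>-fold dilate of the symmetrization, and so exchanges supremum and infimum. Factors
  admissible only for the closure are reached by contracting slightly.\<close>

theorem minkowski_functional_eq_max_chord:
  assumes K: "convex_body K" and v: "v \<noteq> 0"
  shows "minkowski_functional (closure (central_symmetrization K)) v = 2 / max_chord K v"
proof -
  let ?C = "central_symmetrization K" and ?L = "{l. l \<ge> 0 \<and> (\<exists>y\<in>K. \<exists>z\<in>K. z = y + l *\<^sub>R v)}"
  have bK: "bounded K" and cC: "convex ?C"
    using K convex_central_symmetrization by (auto simp: convex_body_def)
  obtain \<rho> where \<rho>: "\<rho> > 0" "ball 0 \<rho> \<subseteq> ?C"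
    using K central_symmetrization_ball by (auto simp: convex_body_def)
  then have \<rho>': "ball 0 \<rho> \<subseteq> closure ?C" using closure_subset by blast
  obtain B where B: "\<And>x. x \<in> K \<Longrightarrow> norm x \<le> B" using bK bounded_iff by blast
  have bdd: "bdd_above ?L"
  proof (rule bdd_aboveI)
    fix l assume "l \<in> ?L"
    then obtain y z where yz: "y \<in> K" "z \<in> K" "z = y + l *\<^sub>R v" "l \<ge> 0" by blast
    then have "l * norm v = norm (z - y)" by simp
    also have "\<dots> \<le> 2 * B" using norm_triangle_ineq4[of z y] B[OF yz(1)] B[OF yz(2)] by linarith
    finally show "l \<le> 2 * B / norm v" using v by (simp add: field_simps)
  qed
  have upper: "l \<le> max_chord K v" if "l \<ge> 0" "(l / 2) *\<^sub>R v \<in> ?C" for l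
    unfolding max_chord_def
    by (rule cSup_upper[OF _ bdd]) (use that chord_iff_central_symmetrization in blast)
  have pos: "max_chord K v > 0"
  proof -
    have "(1 / (2 * norm v / \<rho>)) *\<^sub>R v \<in> ?C"
      by (rule absorbing[OF \<rho>(2)]) (use \<rho> v in auto)
    then have "\<rho> / norm v \<le> max_chord K v"
      using \<rho> by (intro upper) (auto simp: field_simps)
    moreover have "\<rho> / norm v > 0" using \<rho> v by simp
    ultimately show ?thesis by linarith
  qed
  have ge: "2 / max_chord K v \<le> minkowski_functional (closure ?C) v"
  proof (rule minkowski_functional_greatest[OF \<rho>' \<rho>(1)])
    fix l :: real assume l: "l > 0" "(1/l) *\<^sub>R v \<in> closure ?C"
    have "2 / l \<le> max_chord K v"
    proof (rule field_le_mult_one_interval)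
      fix t :: real assume t: "0 < t" "t < 1"
      have "t *\<^sub>R (1/l) *\<^sub>R v \<in> ?C"
        by (rule convex_scaled_closure_subset[OF cC \<rho>(2,1) l(2) t])
      then show "t * (2 / l) \<le> max_chord K v" using t l by (intro upper) auto
    qed
    then show "2 / max_chord K v \<le> l" using pos l by (simp add: field_simps)
  qed
  then have \<phi>_pos: "minkowski_functional (closure ?C) v > 0"
    using pos by (meson divide_pos_pos less_le_trans zero_less_numeral)
  have "max_chord K v \<le> 2 / minkowski_functional (closure ?C) v"
    unfolding max_chord_def
  proof (rule cSup_least)
    have "0 \<in> ?C" using \<rho> by auto
    then have "0 \<in> ?L" using chord_iff_central_symmetrization[of K 0 v] by auto
    then show "?L \<noteq> {}" by blast
  next
    fix l assume "l \<in> ?L"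
    then have l: "l \<ge> 0" "(l / 2) *\<^sub>R v \<in> ?C" using chord_iff_central_symmetrization by blast+
    show "l \<le> 2 / minkowski_functional (closure ?C) v"
    proof (cases "l = 0")
      case False
      then have "minkowski_functional (closure ?C) v \<le> 2 / l"
        using l closure_subset by (intro minkowski_functional_le) auto
      then show ?thesis using False l \<phi>_pos by (simp add: field_simps)
    qed (use \<phi>_pos in simp)
  qed
  then show ?thesis using ge pos \<phi>_pos by (simp add: field_simps)
qed

section \<open>Comparison of the two functionals\<close>

text \<open>With \<open>s\<close> and \<open>s'\<close> the values of the support function at \<open>f\<close> and \<open>- f\<close>, the left-hand side plus
  half the width is the larger of \<open>s\<close> and \<open>s'\<close>, hence at most \<open>max_norm K\<close>.\<close>

lemma asymmetry_bound:
  assumes K: "bounded K" "K \<noteq> {}" and f: "norm f = 1"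
    and w: "0 < w" "w \<le> dir_width K f"
  shows "\<bar>(support_fun K f - support_fun K (- f)) / 2\<bar>
    \<le> (2 * max_norm K / w - 1) * (dir_width K f / 2)"
proof -
  let ?D = "max_norm K"
  have s: "support_fun K f \<le> ?D" "support_fun K (- f) \<le> ?D"
    using support_fun_le_max_norm[OF K, of f] support_fun_le_max_norm[OF K, of "- f"] f by auto
  then have "dir_width K f \<le> 2 * ?D" by (simp add: dir_width_def)
  then have "?D * w \<le> ?D * dir_width K f" using w by (intro mult_left_mono) auto
  then have "?D - dir_width K f / 2 \<le> (2 * ?D / w - 1) * (dir_width K f / 2)"
    using w by (simp add: field_simps)
  moreover have "\<bar>(support_fun K f - support_fun K (- f)) / 2\<bar> \<le> ?D - dir_width K f / 2"
    using s by (simp add: dir_width_def abs_if field_simps)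
  ultimately show ?thesis by linarith
qed

text \<open>Adding the constant \<open>E\<close> to an admissible factor of either functional makes it admissible for the
  other one, up to an arbitrarily small amount in the direction that uses separation. The nonzero
  vector \<open>e\<close> ensures that the dual unit sphere, over which the minimal width is an infimum, is not
  empty.\<close>

theorem gen_minkowski_functional_close:
  fixes K :: "'a::real_normed_vector set"
  assumes K: "convex_body K" and nontriv: "(e :: 'a) \<noteq> 0"
  shows "\<bar>gen_minkowski_functional K x - minkowski_functional (closure (central_symmetrization K)) x\<bar>
    \<le> 2 * max_norm K / min_width K - 1"
proof -
  let ?C = "central_symmetrization K"
  define E where "E = 2 * max_norm K / min_width K - 1"
  let ?A = "{l. l \<ge> 0 \<and> x \<in> dilated_body l K}"
  let ?\<alpha> = "gen_minkowski_functional K x" and ?\<phi> = "minkowski_functional (closure ?C) x"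
  have bK: "bounded K" and cK: "convex K" and ne: "K \<noteq> {}"
    using K interior_subset[of K] by (auto simp: convex_body_def)
  obtain \<rho> where \<rho>: "\<rho> > 0" "ball 0 \<rho> \<subseteq> ?C"
    using K central_symmetrization_ball by (auto simp: convex_body_def)
  then have \<rho>': "ball 0 \<rho> \<subseteq> closure ?C" using closure_subset by blast
  have width_ge: "\<rho> \<le> dir_width K f" if "norm f = 1" for f
    using central_symmetrization_ball_le_dir_width[OF bK \<rho> that] .
  \<comment> \<open>A norm-one functional exists: one that supports the unit ball at the direction of \<open>e\<close>.\<close>
  have "(1 / norm e) *\<^sub>R e \<notin> ball 0 1" using nontriv by simp
  then obtain f0 :: "'a \<Rightarrow>\<^sub>L real" where f0: "norm f0 = 1"
    by (rule convex_support_functional[OF convex_ball order_refl zero_less_one])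
  have w_pos: "min_width K > 0"
  proof -
    have "\<rho> \<le> min_width K"
      unfolding min_width_def by (rule cINF_greatest) (use width_ge f0 in auto)
    then show ?thesis using \<rho> by linarith
  qed
  have w_le: "min_width K \<le> dir_width K f" if "norm f = 1" for f
    unfolding min_width_def
    by (rule cINF_lower) (use width_ge that in \<open>auto intro!: bdd_belowI2[where m = \<rho>]\<close>)
  have asym: "\<bar>(support_fun K f - support_fun K (- f)) / 2\<bar> \<le> E * (dir_width K f / 2)"
    if "norm f = 1" for f
    unfolding E_def by (rule asymmetry_bound[OF bK ne that w_pos w_le[OF that]])
  have E_ge: "E \<ge> 0"
  proof -
    have "0 \<le> E * (dir_width K f0 / 2)" using asym[OF f0] by linarith
    moreover have "dir_width K f0 > 0" using width_ge[OF f0] \<rho> by linarith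
    ultimately show ?thesis by (meson mult_neg_pos linorder_not_less half_gt_zero)
  qed
  have dilated: "x \<in> dilated_body l K \<longleftrightarrow> (\<forall>f. norm f = 1 \<longrightarrow>
      \<bar>blinfun_apply f x - (support_fun K f - support_fun K (- f)) / 2\<bar> \<le> l * (dir_width K f / 2))" for l
    by (auto simp: dilated_body_def mem_dilated_layer_iff)
  have into: "l + E \<in> ?A" if l: "l > 0" "(1/l) *\<^sub>R x \<in> closure ?C" for l
  proof -
    have "\<bar>blinfun_apply f x - (support_fun K f - support_fun K (- f)) / 2\<bar>
        \<le> (l + E) * (dir_width K f / 2)" if f: "norm f = 1" for f
    proof -
      have "\<bar>blinfun_apply f ((1/l) *\<^sub>R x)\<bar> \<le> dir_width K f / 2"
        by (rule closure_central_symmetrization_dir_width[OF bK l(2)])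
      then have "\<bar>blinfun_apply f x\<bar> \<le> l * (dir_width K f / 2)"
        using l(1) by (simp add: blinfun.scaleR_right abs_mult field_simps)
      then show ?thesis using asym[OF f] unfolding distrib_right by linarith
    qed
    then show ?thesis using l E_ge dilated by simp
  qed
  have "?\<alpha> - E \<le> ?\<phi>"
  proof (rule minkowski_functional_greatest[OF \<rho>' \<rho>(1)])
    fix l :: real assume "l > 0" "(1/l) *\<^sub>R x \<in> closure ?C"
    from into[OF this] have "?\<alpha> \<le> l + E"
      unfolding gen_minkowski_functional_def
      by (rule cInf_lower) (auto intro!: bdd_belowI[where m = 0])
    then show "?\<alpha> - E \<le> l" by linarith
  qed
  moreover have "?\<phi> - E \<le> ?\<alpha>"
    unfolding gen_minkowski_functional_def
  proof (rule cInf_greatest)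
    obtain l where "l > 0" "(1/l) *\<^sub>R x \<in> closure ?C" using absorbing_ex[OF \<rho>' \<rho>(1)] .
    from into[OF this] show "?A \<noteq> {}" by blast
  next
    fix l assume "l \<in> ?A"
    then have l: "l \<ge> 0" and xl: "x \<in> dilated_body l K" by auto
    have "?\<phi> \<le> l + E"
    \<comment> \<open>Separation is not strict, so the point is scaled by a factor \<open>m\<close> strictly above \<open>l + E\<close>.\<close>
    proof (rule dense_ge)
      fix m assume m: "l + E < m"
      then have m0: "m > 0" using l E_ge by linarith
      have "(1/m) *\<^sub>R x \<in> ?C"
      proof (rule ccontr)
        assume "(1/m) *\<^sub>R x \<notin> ?C"
        then obtain f where f: "norm f = 1" "dir_width K f / 2 \<le> blinfun_apply f ((1/m) *\<^sub>R x)"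
          using central_symmetrization_separation[OF cK ne \<rho>] by metis
        have "m * (dir_width K f / 2) \<le> blinfun_apply f x"
          using f(2) m0 by (simp add: blinfun.scaleR_right field_simps)
        also have "\<dots> \<le> (l + E) * (dir_width K f / 2)"
        proof -
          have "\<bar>blinfun_apply f x - (support_fun K f - support_fun K (- f)) / 2\<bar>
              \<le> l * (dir_width K f / 2)"
            using xl f(1) dilated by blast
          then show ?thesis using asym[OF f(1)] unfolding distrib_right by linarith
        qed
        also have "\<dots> < m * (dir_width K f / 2)"
          using m width_ge[OF f(1)] \<rho> by (intro mult_strict_right_mono) auto
        finally show False by simp
      qed
      then show "?\<phi> \<le> m"
        using m0 closure_subset by (intro minkowski_functional_le) auto
    qed
    then show "?\<phi> - E \<le> l" by linarith
  qed
  ultimately show ?thesis unfolding E_def by linarith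
qed

theorem theorem5p7:
  fixes K :: "'a::real_normed_vector set" and x :: 'a
  assumes "convex_body K" and "x \<noteq> 0"
  shows "\<bar>gen_minkowski_functional K x
            - minkowski_functional (closure (central_symmetrization K)) x\<bar>
          = \<bar>gen_minkowski_functional K x - 2 * norm x / max_chord K (x /\<^sub>R norm x)\<bar>
       \<and> \<bar>gen_minkowski_functional K x - 2 * norm x / max_chord K (x /\<^sub>R norm x)\<bar>
          \<le> 2 * max_norm K / min_width K - 1"
proof -
  let ?C = "closure (central_symmetrization K)"
  obtain \<rho> where \<rho>: "\<rho> > 0" "ball 0 \<rho> \<subseteq> central_symmetrization K"
    using assms(1) central_symmetrization_ball by (auto simp: convex_body_def)
  have "sublinear (minkowski_functional ?C)"
    using assms(1) \<rho> closure_subset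
    by (intro sublinear_minkowski_functional[of _ \<rho>] convex_closure convex_central_symmetrization)
      (auto simp: convex_body_def)
  then have "minkowski_functional ?C (norm x *\<^sub>R (x /\<^sub>R norm x))
      = norm x * minkowski_functional ?C (x /\<^sub>R norm x)"
    by (rule sublinear_scale) (use assms(2) in simp)
  also have "minkowski_functional ?C (x /\<^sub>R norm x) = 2 / max_chord K (x /\<^sub>R norm x)"
    using assms by (intro minkowski_functional_eq_max_chord) auto
  finally have "minkowski_functional ?C x = 2 * norm x / max_chord K (x /\<^sub>R norm x)"
    using assms(2) by simp
  then show ?thesis using gen_minkowski_functional_close[OF assms, of x] by simp
qed

end
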